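(* Let $P$ be a finite poset, $\ell,q$ positive integers, $u,v$ as in the context, and assume $R^q$ is defined. The map $\Psi$ defined in the context is a bijection from $\mathcal L_{P\times[\ell]}(u,v,R^q)$ onto $\mathcal A^{\overline B}(\Gamma(P,\overline R))$, and for every integer $k$ and every $f\in\mathcal L_{P\times[\ell]}(u,v,R^q)$, $\Psi(\rho_k(f))=\tau_k(\Psi(f))$.
   Context: $P\times[\ell]=\{(p,i):p\in P,1\le i\le\ell\}$; $u,v:P\to\{0,\ldots,\ell\}$ satisfy $u(p)+v(p)\le\ell$ and $v(p_1)\le v(p_2)$, $u(p_1)\ge u(p_2)$ when $p_1\le_Pp_2$; $P\times[\ell]^v_u=\{(p,i):u(p)<i<\ell+1-v(p)\}$, fibers $F_p=\{(p,i)\in P\times[\ell]^v_u\}$. For a map $R$ from $P$ to nonempty finite subsets of $\mathbb Z$, $\mathcal L_{P\times[\ell]}(u,v,R)$ is the set of $f:P\times[\ell]^v_u\to\mathbb Z$ with $f(p_1,i)<f(p_2,i)$ for $p_1<_Pp_2$, $f(p,i_1)\le f(p,i_2)$ for $i_1\le i_2$, $f(p,i)\in R(p)$. $R^q(p)$: the set of $k\in\{1,\ldots,q\}$ attained as $f(p,i)$ by some $f\in\mathcal L_{P\times[\ell]}(u,v,p\mapsto\{1,\ldots,q\})$ (assumed nonempty). With $R=R^q$: $R(p)_{>k}$ is the smallest element of $R(p)$ above $k$; $f(p,i)$ is raisable (lowerable) if some $g\in\mathcal L_{P\times[\ell]}(u,v,R)$ has $g(p,i)>f(p,i)$ (resp.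 $<$) and $g(p',i')=f(p',i')$ whenever $p'\ne p$. Bender–Knuth $\rho_k$: in each fiber $F_p$ with $k\in R(p)$, $k\ne\max R(p)$ (others unchanged), free labels are raisable labels equal to $k$ and lowerable labels equal to $R(p)_{>k}$; if they read $a$ copies of $k$ then $b$ copies of $R(p)_{>k}$, replace them by $b$ copies of $k$ then $a$ copies of $R(p)_{>k}$. $\Gamma(P,\overline R)$ is the poset on $\{(p,k):p\in P,\ 0\le k\le q\}$ whose covering relations are $(p,k)\lessdot(p,k-1)$ for $1\le k\le q$ and $(p,k-1)\lessdot(p',k)$ whenever $p\lessdot_Pp'$ and $1\le k\le q$. $W=\{(p,0),(p,q):p\in P\}$ and $\overline B:W\to\{0,\ldots,\ell\}$ is $\overline B(p,0)=\ell-u(p)$, $\overline B(p,q)=v(p)$. $\mathcal A^{\overline B}(\Gamma(P,\overline R))$ is the set of order-preserving $\sigma:\Gamma(P,\overline R)\to\{0,\ldots,\ell\}$ with $\sigma|_W=\overline B$. For $x\notin W$ the toggle $\tau_x$ replaces $\sigma(x)$ by $\min_{y\gtrdot x}\sigma(y)+\max_{z\lessdot x}\sigma(z)-\sigma(x)$ and leaves other values unchanged; $\tau_k$ is the composition of $\tau_{(p,k)}$ over all $p$ with $(p,k)\notin W$ (the identity if there are none). For $f\in\mathcal L_{P\times[\ell]}(u,v,R^q)$ and $k\in\mathbb Z$ let $j^p_k=\min\{j:(p,j)\in F_p,\ f(p,j)>k\}$ if this set is nonempty and $j^p_k=\ell-v(p)+1$ otherwise; then $\Psi(f)(p,k)=\ell+1-j^p_k$.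 *)

theory Defs
  imports Main "HOL-Library.FuncSet"
begin

text \<open>
  A finite poset is a finite carrier \<open>P\<close> with a relation \<open>r\<close> such that \<open>partial_order_on P r\<close>;
  \<open>(p, p') \<in> r\<close> is read \<open>p \<le> p'\<close>. All indices and labels are integers. Functions with a
  restricted domain are extensional, so that equality of functions is equality on the domain.
\<close>

definition covers :: "'a set \<Rightarrow> ('a \<times> 'a) set \<Rightarrow> ('a \<times> 'a) set" where
  "covers P r = {(x, y). x \<in> P \<and> y \<in> P \<and> (x, y) \<in> r \<and> x \<noteq> y \<and>
     \<not> (\<exists>z\<in>P. (x, z) \<in> r \<and> (z, y) \<in> r \<and> z \<noteq> x \<and> z \<noteq> y)}"

section \<open>P-strict labelings\<close>

definition label_dom :: "'a set \<Rightarrow> int \<Rightarrow> ('a \<Rightarrow> int) \<Rightarrow> ('a \<Rightarrow> int) \<Rightarrow> ('a \<times> int) set" where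
  "label_dom P l u v = {(p, i). (p, i) \<in> P \<times> {1..l} \<and> u p < i \<and> i < l + 1 - v p}"

definition fiber :: "'a set \<Rightarrow> int \<Rightarrow> ('a \<Rightarrow> int) \<Rightarrow> ('a \<Rightarrow> int) \<Rightarrow> 'a \<Rightarrow> ('a \<times> int) set" where
  "fiber P l u v p = {x \<in> label_dom P l u v. fst x = p}"

definition strict_labelings ::
  "'a set \<Rightarrow> ('a \<times> 'a) set \<Rightarrow> int \<Rightarrow> ('a \<Rightarrow> int) \<Rightarrow> ('a \<Rightarrow> int) \<Rightarrow> ('a \<Rightarrow> int set)
     \<Rightarrow> ('a \<times> int \<Rightarrow> int) set" where
  "strict_labelings P r l u v R =
     {f \<in> label_dom P l u v \<rightarrow>\<^sub>E (UNIV :: int set).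
        (\<forall>p1 p2 i. (p1, p2) \<in> r \<and> p1 \<noteq> p2 \<and>
           (p1, i) \<in> label_dom P l u v \<and> (p2, i) \<in> label_dom P l u v
             \<longrightarrow> f (p1, i) < f (p2, i)) \<and>
        (\<forall>p i1 i2. i1 \<le> i2 \<and>
           (p, i1) \<in> label_dom P l u v \<and> (p, i2) \<in> label_dom P l u v
             \<longrightarrow> f (p, i1) \<le> f (p, i2)) \<and>
        (\<forall>p i. (p, i) \<in> label_dom P l u v \<longrightarrow> f (p, i) \<in> R p)}"

definition global_restr ::
  "'a set \<Rightarrow> ('a \<times> 'a) set \<Rightarrow> int \<Rightarrow> ('a \<Rightarrow> int) \<Rightarrow> ('a \<Rightarrow> int) \<Rightarrow> int \<Rightarrow> 'a \<Rightarrow> int set" where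
  "global_restr P r l u v q p =
     {k \<in> {1..q}. \<exists>f \<in> strict_labelings P r l u v (\<lambda>_. {1..q}).
        \<exists>i. (p, i) \<in> label_dom P l u v \<and> f (p, i) = k}"

section \<open>Bender--Knuth involutions\<close>

definition next_label :: "('a \<Rightarrow> int set) \<Rightarrow> 'a \<Rightarrow> int \<Rightarrow> int" where
  "next_label R p k = Min {m \<in> R p. k < m}"

definition raisable ::
  "'a set \<Rightarrow> ('a \<times> 'a) set \<Rightarrow> int \<Rightarrow> ('a \<Rightarrow> int) \<Rightarrow> ('a \<Rightarrow> int) \<Rightarrow> ('a \<Rightarrow> int set)
     \<Rightarrow> ('a \<times> int \<Rightarrow> int) \<Rightarrow> 'a \<Rightarrow> int \<Rightarrow> bool" where
  "raisable P r l u v R f p i \<longleftrightarrow>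
     (\<exists>g \<in> strict_labelings P r l u v R. f (p, i) < g (p, i) \<and>
        (\<forall>p' i'. (p', i') \<in> label_dom P l u v \<and> p' \<noteq> p \<longrightarrow> g (p', i') = f (p', i')))"

definition lowerable ::
  "'a set \<Rightarrow> ('a \<times> 'a) set \<Rightarrow> int \<Rightarrow> ('a \<Rightarrow> int) \<Rightarrow> ('a \<Rightarrow> int) \<Rightarrow> ('a \<Rightarrow> int set)
     \<Rightarrow> ('a \<times> int \<Rightarrow> int) \<Rightarrow> 'a \<Rightarrow> int \<Rightarrow> bool" where
  "lowerable P r l u v R f p i \<longleftrightarrow>
     (\<exists>g \<in> strict_labelings P r l u v R. g (p, i) < f (p, i) \<and>
        (\<forall>p' i'. (p', i') \<in> label_dom P l u v \<and> p' \<noteq> p \<longrightarrow> g (p', i') = f (p', i')))"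

definition free_low ::
  "'a set \<Rightarrow> ('a \<times> 'a) set \<Rightarrow> int \<Rightarrow> ('a \<Rightarrow> int) \<Rightarrow> ('a \<Rightarrow> int) \<Rightarrow> ('a \<Rightarrow> int set)
     \<Rightarrow> int \<Rightarrow> ('a \<times> int \<Rightarrow> int) \<Rightarrow> 'a \<Rightarrow> int set" where
  "free_low P r l u v R k f p =
     {i. (p, i) \<in> fiber P l u v p \<and> f (p, i) = k \<and> raisable P r l u v R f p i}"

definition free_high ::
  "'a set \<Rightarrow> ('a \<times> 'a) set \<Rightarrow> int \<Rightarrow> ('a \<Rightarrow> int) \<Rightarrow> ('a \<Rightarrow> int) \<Rightarrow> ('a \<Rightarrow> int set)
     \<Rightarrow> int \<Rightarrow> ('a \<times> int \<Rightarrow> int) \<Rightarrow> 'a \<Rightarrow> int set" where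
  "free_high P r l u v R k f p =
     {i. (p, i) \<in> fiber P l u v p \<and> f (p, i) = next_label R p k \<and> lowerable P r l u v R f p i}"

text \<open>
  In each active fiber, with \<open>a = card (free_low \<dots>)\<close> and \<open>b = card (free_high \<dots>)\<close>, the first \<open>b\<close>
  of the \<open>a + b\<close> free positions receive \<open>k\<close> and the remaining \<open>a\<close> receive the next label.
\<close>

definition bender_knuth ::
  "'a set \<Rightarrow> ('a \<times> 'a) set \<Rightarrow> int \<Rightarrow> ('a \<Rightarrow> int) \<Rightarrow> ('a \<Rightarrow> int) \<Rightarrow> ('a \<Rightarrow> int set)
     \<Rightarrow> int \<Rightarrow> ('a \<times> int \<Rightarrow> int) \<Rightarrow> ('a \<times> int \<Rightarrow> int)" where
  "bender_knuth P r l u v R k f = (\<lambda>(p, i).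
     let S = free_low P r l u v R k f p \<union> free_high P r l u v R k f p;
         b = card (free_high P r l u v R k f p)
     in if p \<in> P \<and> k \<in> R p \<and> k \<noteq> Max (R p) \<and> i \<in> S
        then (if card {j \<in> S. j < i} < b then k else next_label R p k)
        else f (p, i))"

section \<open>The poset \<open>\<Gamma>\<close>\<close>

definition gamma :: "'a set \<Rightarrow> int \<Rightarrow> ('a \<times> int) set" where
  "gamma P q = P \<times> {0..q}"

definition gamma_cover :: "'a set \<Rightarrow> ('a \<times> 'a) set \<Rightarrow> int \<Rightarrow> (('a \<times> int) \<times> ('a \<times> int)) set" where
  "gamma_cover P r q =
     {((p, k), (p, k - 1)) | p k. p \<in> P \<and> 1 \<le> k \<and> k \<le> q} \<union>
     {((p, k - 1), (p', k)) | p p' k. (p, p') \<in> covers P r \<and> 1 \<le> k \<and> k \<le> q}"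

definition gamma_le :: "'a set \<Rightarrow> ('a \<times> 'a) set \<Rightarrow> int \<Rightarrow> (('a \<times> int) \<times> ('a \<times> int)) set" where
  "gamma_le P r q = (gamma_cover P r q)\<^sup>* \<inter> gamma P q \<times> gamma P q"

lemma gamma_cover_subset: "gamma_cover P r q \<subseteq> gamma P q \<times> gamma P q"
  by (auto simp: gamma_cover_def gamma_def covers_def)

lemma gamma_reach:
  assumes "partial_order_on P r" and "((p, k), (p', k')) \<in> gamma_le P r q"
  shows "(p, p') \<in> r \<and> (p = p' \<longrightarrow> k' \<le> k) \<and> ((p, p') \<in> covers P r \<longrightarrow> k' \<le> k + 1)"
proof -
  have r: "refl_on P r" "trans r" "antisym r"
    using partial_order_onD[OF assms(1)] by auto
  have p: "p \<in> P" and reach: "((p, k), (p', k')) \<in> (gamma_cover P r q)\<^sup>*"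
    using assms(2) by (auto simp: gamma_le_def gamma_def)
  from reach show ?thesis
  proof (induction p' k' rule: rtrancl_induct2)
    case refl
    then show ?case using p r(1) by (auto simp: refl_on_def)
  next
    case (step a m b n)
    from step.hyps(2) consider "b = a" "n = m - 1" | "(a, b) \<in> covers P r" "n = m + 1"
      by (auto simp: gamma_cover_def)
    then show ?case
    proof cases
      case 1
      then show ?thesis using step.IH by auto
    next
      case 2
      have ab: "(a, b) \<in> r" "a \<noteq> b" "a \<in> P" using 2 by (auto simp: covers_def)
      have pa: "(p, a) \<in> r" using step.IH by auto
      have "p \<noteq> b" using ab pa r(3) by (auto dest: antisymD)
      moreover have "(p, b) \<in> r" using ab pa r(2) by (auto dest: transD)
      moreover have "a = p" if "(p, b) \<in> covers P r"
        using that ab pa by (auto simp: covers_def)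
      ultimately show ?thesis using 2 step.IH by auto
    qed
  qed
qed

lemma partial_order_on_gamma:
  assumes "partial_order_on P r"
  shows "partial_order_on (gamma P q) (gamma_le P r q)"
proof -
  have "trans (gamma_le P r q)"
    by (auto simp: gamma_le_def intro!: transI)
  moreover have "refl_on (gamma P q) (gamma_le P r q)"
    by (auto simp: gamma_le_def refl_on_def)
  moreover have "antisym (gamma_le P r q)"
  proof (rule antisymI, clarify)
    fix p k p' k'
    assume A: "((p, k), (p', k')) \<in> gamma_le P r q" "((p', k'), (p, k)) \<in> gamma_le P r q"
    have "p = p'"
      using gamma_reach[OF assms A(1)] gamma_reach[OF assms A(2)] partial_order_onD(3)[OF assms]
      by (auto dest: antisymD)
    then show "p = p' \<and> k = k'"
      using gamma_reach[OF assms A(1)] gamma_reach[OF assms A(2)] by auto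
  qed
  ultimately show ?thesis
    by (auto simp: partial_order_on_def preorder_on_def gamma_le_def)
qed

lemma covers_gamma:
  assumes "partial_order_on P r"
  shows "covers (gamma P q) (gamma_le P r q) = gamma_cover P r q"
proof (intro subset_antisym subsetI)
  fix e assume e: "e \<in> covers (gamma P q) (gamma_le P r q)"
  obtain x y where xy: "e = (x, y)" by (cases e)
  have "(x, y) \<in> (gamma_cover P r q)\<^sup>*" "x \<noteq> y"
    using e by (auto simp: xy covers_def gamma_le_def)
  then obtain z where z: "(x, z) \<in> gamma_cover P r q" "(z, y) \<in> (gamma_cover P r q)\<^sup>*"
    by (auto elim: converse_rtranclE)
  have "z \<noteq> x" using z(1) by (auto simp: gamma_cover_def covers_def)
  moreover have "z \<in> gamma P q" "x \<in> gamma P q" using z(1) gamma_cover_subset by blast+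
  moreover have "y \<in> gamma P q" using e by (auto simp: xy covers_def)
  ultimately have "z = y"
    using e z by (auto simp: xy covers_def gamma_le_def)
  then show "e \<in> gamma_cover P r q" using z xy by simp
next
  fix e assume e: "e \<in> gamma_cover P r q"
  obtain p k p' k' where xy: "e = ((p, k), (p', k'))" by (metis surj_pair)
  have in_gamma: "(p, k) \<in> gamma P q" "(p', k') \<in> gamma P q"
    using e gamma_cover_subset unfolding xy by blast+
  have le: "((p, k), (p', k')) \<in> gamma_le P r q"
    using e in_gamma by (auto simp: xy gamma_le_def)
  have ne: "(p, k) \<noteq> (p', k')" using e by (auto simp: xy gamma_cover_def covers_def)
  have "z = (p, k) \<or> z = (p', k')"
    if z: "((p, k), z) \<in> gamma_le P r q" "(z, (p', k')) \<in> gamma_le P r q" for z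
  proof -
    obtain a m where am: "z = (a, m)" by (cases z)
    note R1 = gamma_reach[OF assms z(1)[unfolded am]]
    note R2 = gamma_reach[OF assms z(2)[unfolded am]]
    have aP: "a \<in> P" using z by (auto simp: am gamma_le_def gamma_def)
    from e consider "p' = p" "k' = k - 1" | "(p, p') \<in> covers P r" "k' = k + 1"
      by (auto simp: xy gamma_cover_def)
    then show ?thesis
    proof cases
      case 1
      then have "a = p" using R1 R2 partial_order_onD(3)[OF assms] by (auto dest: antisymD)
      then show ?thesis using 1 R1 R2 am by auto
    next
      case 2
      then have "a = p \<or> a = p'" using R1 R2 aP by (auto simp: covers_def)
      then show ?thesis using 2 R1 R2 am by auto
    qed
  qed
  then show "e \<in> covers (gamma P q) (gamma_le P r q)"
    using in_gamma le ne by (auto simp: xy covers_def)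
qed

definition gamma_W :: "'a set \<Rightarrow> int \<Rightarrow> ('a \<times> int) set" where
  "gamma_W P q = P \<times> {0, q}"

definition gamma_B :: "int \<Rightarrow> ('a \<Rightarrow> int) \<Rightarrow> ('a \<Rightarrow> int) \<Rightarrow> 'a \<times> int \<Rightarrow> int" where
  "gamma_B l u v = (\<lambda>(p, k). if k = 0 then l - u p else v p)"

definition gamma_parts ::
  "'a set \<Rightarrow> ('a \<times> 'a) set \<Rightarrow> int \<Rightarrow> ('a \<Rightarrow> int) \<Rightarrow> ('a \<Rightarrow> int) \<Rightarrow> int
     \<Rightarrow> ('a \<times> int \<Rightarrow> int) set" where
  "gamma_parts P r l u v q =
     {\<sigma> \<in> gamma P q \<rightarrow>\<^sub>E {0..l}.
        monotone_on (gamma P q) (\<lambda>x y. (x, y) \<in> gamma_le P r q) (\<le>) \<sigma> \<and>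
        (\<forall>w \<in> gamma_W P q. \<sigma> w = gamma_B l u v w)}"

section \<open>Toggles\<close>

definition toggle ::
  "'a set \<Rightarrow> ('a \<times> 'a) set \<Rightarrow> int \<Rightarrow> 'a \<times> int \<Rightarrow> ('a \<times> int \<Rightarrow> int) \<Rightarrow> ('a \<times> int \<Rightarrow> int)" where
  "toggle P r q x \<sigma> =
     \<sigma>(x := Min (\<sigma> ` {y. (x, y) \<in> gamma_cover P r q})
           + Max (\<sigma> ` {z. (z, x) \<in> gamma_cover P r q}) - \<sigma> x)"

text \<open>Toggles at the same height commute, so the composition is independent of the order.\<close>

lemma toggle_commute:
  "toggle P r q (p, k) \<circ> toggle P r q (p', k) = toggle P r q (p', k) \<circ> toggle P r q (p, k)"
proof (cases "p = p'")
  case False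
  have up: "toggle P r q (b, k) \<sigma> ` {y. ((a, k), y) \<in> gamma_cover P r q}
      = \<sigma> ` {y. ((a, k), y) \<in> gamma_cover P r q}" for a b \<sigma>
    by (rule image_cong) (auto simp: toggle_def gamma_cover_def)
  have down: "toggle P r q (b, k) \<sigma> ` {z. (z, (a, k)) \<in> gamma_cover P r q}
      = \<sigma> ` {z. (z, (a, k)) \<in> gamma_cover P r q}" for a b \<sigma>
    by (rule image_cong) (auto simp: toggle_def gamma_cover_def)
  have val: "toggle P r q (a, k) (toggle P r q (b, k) \<sigma>) =
      \<sigma>((b, k) := toggle P r q (b, k) \<sigma> (b, k), (a, k) := toggle P r q (a, k) \<sigma> (a, k))"
    if "a \<noteq> b" for a b \<sigma>
    unfolding toggle_def[of P r q "(a, k)" "toggle P r q (b, k) \<sigma>"] up down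
    using that by (simp add: toggle_def)
  show ?thesis
    using False by (intro ext) (auto simp: val fun_upd_def)
qed simp

definition toggle_row ::
  "'a set \<Rightarrow> ('a \<times> 'a) set \<Rightarrow> int \<Rightarrow> int \<Rightarrow> ('a \<times> int \<Rightarrow> int) \<Rightarrow> ('a \<times> int \<Rightarrow> int)" where
  "toggle_row P r q k \<sigma> =
     Finite_Set.fold (\<lambda>p. toggle P r q (p, k)) \<sigma> {p. (p, k) \<in> gamma P q - gamma_W P q}"

section \<open>The map \<open>\<Psi>\<close>\<close>

definition jump ::
  "'a set \<Rightarrow> int \<Rightarrow> ('a \<Rightarrow> int) \<Rightarrow> ('a \<Rightarrow> int) \<Rightarrow> ('a \<times> int \<Rightarrow> int) \<Rightarrow> 'a \<Rightarrow> int \<Rightarrow> int" where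
  "jump P l u v f p k =
     (let J = {j. (p, j) \<in> fiber P l u v p \<and> k < f (p, j)}
      in if J \<noteq> {} then Min J else l - v p + 1)"

definition Psi ::
  "'a set \<Rightarrow> int \<Rightarrow> ('a \<Rightarrow> int) \<Rightarrow> ('a \<Rightarrow> int) \<Rightarrow> int \<Rightarrow> ('a \<times> int \<Rightarrow> int) \<Rightarrow> ('a \<times> int \<Rightarrow> int)" where
  "Psi P l u v q f = (\<lambda>(p, k) \<in> gamma P q. l + 1 - jump P l u v f p k)"

end

theory Submission
  imports Defs
begin

text \<open>
  In the fiber over \<open>p\<close> the labeling \<open>f\<close> is encoded by its jumps: \<open>k < f (p, i)\<close> iff
  \<open>jump p k \<le> i\<close>. Strictness along covers of \<open>P\<close> becomes monotonicity of \<open>\<Psi> f\<close> on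
  \<open>\<Gamma>\<close>, whence the bijection. For \<open>0 < k < q\<close> put \<open>A = l + 1 - min\<close> and
  \<open>B = l + 1 - max\<close>, where the minimum and maximum of \<open>\<Psi> f\<close> are over the upper and lower covers
  of \<open>(p, k)\<close>. The raisable labels \<open>k\<close> occupy exactly the positions \<open>A \<le> i < jump p k\<close> and the
  lowerable labels \<open>k + 1\<close> exactly \<open>jump p k \<le> i < B\<close>, so exchanging their numbers moves the jump
  to \<open>A + B - jump p k\<close>, which is the toggle. A raisable label \<open>k\<close> can always be raised to \<open>k + 1\<close>;
  hence if \<open>k + 1\<close> is not the next element of \<open>R p\<close> after \<open>k\<close>, no label is free, both intervals
  are empty, and the toggle is trivial as well.
\<close>

section \<open>Restriction sets, rows of toggles, and recognising jumps\<close>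

text \<open>Each label of \<open>f\<close> is attained by \<open>f\<close> itself, so it lies in the
  restriction set. Later arguments can therefore work with the constant label set
  \<open>{1..q}\<close>.\<close>

lemma strict_labelings_global_restr:
  "strict_labelings P r l u v (global_restr P r l u v q) = strict_labelings P r l u v (\<lambda>_. {1..q})"
proof
  show "strict_labelings P r l u v (global_restr P r l u v q)
      \<subseteq> strict_labelings P r l u v (\<lambda>_. {1..q})"
    by (auto simp: strict_labelings_def global_restr_def)
  show "strict_labelings P r l u v (\<lambda>_. {1..q})
      \<subseteq> strict_labelings P r l u v (global_restr P r l u v q)"
  proof
    fix f assume f: "f \<in> strict_labelings P r l u v (\<lambda>_. {1..q})"
    have "f (p, i) \<in> global_restr P r l u v q p" if "(p, i) \<in> label_dom P l u v" for p i
    proof -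
      have "f (p, i) \<in> {1..q}"
        using f that unfolding strict_labelings_def by blast
      then show ?thesis
        unfolding global_restr_def using f that by blast
    qed
    then show "f \<in> strict_labelings P r l u v (global_restr P r l u v q)"
      using f unfolding strict_labelings_def by blast
  qed
qed

text \<open>Covers in \<Gamma> change the height by exactly one, so a toggle at height
  \<open>k\<close> reads no other value at that height. The toggles of a row therefore all act on
  the original \<open>\<sigma>\<close> simultaneously.\<close>

lemma fold_toggle:
  assumes "finite S"
  shows "Finite_Set.fold (\<lambda>p. toggle P r q (p, k)) \<sigma> S =
    (\<lambda>(p, m). if m = k \<and> p \<in> S then toggle P r q (p, k) \<sigma> (p, k) else \<sigma> (p, m))"
  using assms
proof (induction S rule: finite_induct)
  case empty
  then show ?case by auto
next
  case (insert a S)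
  interpret comp_fun_commute "\<lambda>p. toggle P r q (p, k)"
    by unfold_locales (rule toggle_commute)
  let ?\<tau> = "\<lambda>(p, m). if m = k \<and> p \<in> S then toggle P r q (p, k) \<sigma> (p, k) else \<sigma> (p, m)"
  have up: "?\<tau> ` {y. ((a, k), y) \<in> gamma_cover P r q} = \<sigma> ` {y. ((a, k), y) \<in> gamma_cover P r q}"
    by (rule image_cong) (auto simp: gamma_cover_def)
  have down: "?\<tau> ` {z. (z, (a, k)) \<in> gamma_cover P r q} = \<sigma> ` {z. (z, (a, k)) \<in> gamma_cover P r q}"
    by (rule image_cong) (auto simp: gamma_cover_def)
  have "toggle P r q (a, k) ?\<tau> = ?\<tau>((a, k) := toggle P r q (a, k) \<sigma> (a, k))"
    unfolding toggle_def[of P r q "(a, k)" ?\<tau>] up down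
    using insert.hyps(2) by (simp add: toggle_def)
  also have "\<dots> = (\<lambda>(p, m). if m = k \<and> p \<in> insert a S then toggle P r q (p, k) \<sigma> (p, k)
      else \<sigma> (p, m))"
    by (auto simp: fun_eq_iff)
  finally show ?case
    unfolding fold_insert[OF insert.hyps] insert.IH .
qed

text \<open>Since \<open>f\<close> is an arbitrary function, this also evaluates jumps of a
  Bender-Knuth image directly. The extreme value \<open>j = l - v p + 1\<close> is the case of an
  empty set, where \<open>jump\<close> takes its default.\<close>

lemma jump_eqI:
  assumes "u p < j" "j \<le> l - v p + 1" "p \<in> P" "0 \<le> u p" "0 \<le> v p"
    and iff: "\<And>i. (p, i) \<in> label_dom P l u v \<Longrightarrow> k < f (p, i) \<longleftrightarrow> j \<le> i"
  shows "jump P l u v f p k = j"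
proof -
  have "{i. (p, i) \<in> fiber P l u v p \<and> k < f (p, i)} = {j..l - v p}"
    using assms(1-5) iff by (auto simp: fiber_def label_dom_def)
  moreover have "Min {j..l - v p} = j" if "j \<le> l - v p"
    using that by (intro Min_eqI) auto
  ultimately show ?thesis
    using assms(2) by (auto simp: jump_def)
qed

section \<open>Labelings and their description by covers\<close>

locale strict_labeling_setup =
  fixes P :: "'a set" and r :: "('a \<times> 'a) set" and l q :: int and u v :: "'a \<Rightarrow> int"
  assumes fin: "finite P" and po: "partial_order_on P r" and q_pos: "0 < q"
    and u_nonneg: "\<And>p. p \<in> P \<Longrightarrow> 0 \<le> u p" and v_nonneg: "\<And>p. p \<in> P \<Longrightarrow> 0 \<le> v p"
    and uv_le: "\<And>p. p \<in> P \<Longrightarrow> u p + v p \<le> l"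
    and v_mono: "\<And>p1 p2. (p1, p2) \<in> r \<Longrightarrow> v p1 \<le> v p2"
    and u_antimono: "\<And>p1 p2. (p1, p2) \<in> r \<Longrightarrow> u p2 \<le> u p1"
begin

abbreviation "D \<equiv> label_dom P l u v"
abbreviation "L \<equiv> strict_labelings P r l u v (\<lambda>_. {1..q})"
abbreviation "R \<equiv> global_restr P r l u v q"
abbreviation "J \<equiv> jump P l u v"

lemma D_iff: "(p, i) \<in> D \<longleftrightarrow> p \<in> P \<and> u p < i \<and> i \<le> l - v p"
  using u_nonneg[of p] v_nonneg[of p] by (auto simp: label_dom_def)

lemma coversD: "(p, p') \<in> covers P r \<Longrightarrow> p \<in> P \<and> p' \<in> P \<and> (p, p') \<in> r \<and> p \<noteq> p'"
  by (auto simp: covers_def)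

lemma L_strict: "f \<in> L \<Longrightarrow> (p, p') \<in> r \<Longrightarrow> p \<noteq> p' \<Longrightarrow> (p, i) \<in> D \<Longrightarrow> (p', i) \<in> D \<Longrightarrow>
    f (p, i) < f (p', i)"
  unfolding strict_labelings_def by blast

lemma L_mono: "f \<in> L \<Longrightarrow> i \<le> j \<Longrightarrow> (p, i) \<in> D \<Longrightarrow> (p, j) \<in> D \<Longrightarrow> f (p, i) \<le> f (p, j)"
  unfolding strict_labelings_def by blast

lemma L_range: "f \<in> L \<Longrightarrow> (p, i) \<in> D \<Longrightarrow> 1 \<le> f (p, i) \<and> f (p, i) \<le> q"
  unfolding strict_labelings_def by auto

lemma L_extensional: "f \<in> L \<Longrightarrow> x \<notin> D \<Longrightarrow> f x = undefined"
  unfolding strict_labelings_def by auto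

lemma L_in_R: "f \<in> L \<Longrightarrow> (p, i) \<in> D \<Longrightarrow> f (p, i) \<in> R p"
  unfolding strict_labelings_global_restr[symmetric] by (simp add: strict_labelings_def)

text \<open>
  Covers suffice because each layer \<open>{p. (p, i) \<in> D}\<close> is convex in \<open>P\<close>, by the monotonicity of
  \<open>u\<close> and \<open>v\<close>.
\<close>

lemma L_coverI:
  assumes ext: "\<And>x. x \<notin> D \<Longrightarrow> f x = undefined"
    and cover: "\<And>p p' i. (p, p') \<in> covers P r \<Longrightarrow> (p, i) \<in> D \<Longrightarrow> (p', i) \<in> D \<Longrightarrow> f (p, i) < f (p', i)"
    and mono: "\<And>p i j. i \<le> j \<Longrightarrow> (p, i) \<in> D \<Longrightarrow> (p, j) \<in> D \<Longrightarrow> f (p, i) \<le> f (p, j)"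
    and range: "\<And>p i. (p, i) \<in> D \<Longrightarrow> 1 \<le> f (p, i) \<and> f (p, i) \<le> q"
  shows "f \<in> L"
proof -
  have tr: "trans r" and anti: "antisym r"
    using partial_order_onD[OF po] by auto
  \<comment> \<open>The induction runs on the size of the closed interval between \<open>a\<close>
    and \<open>b\<close>. Splitting at \<open>z\<close> loses \<open>b\<close> from one half and
    \<open>a\<close> from the other.\<close>
  define I where "I a b = {z \<in> P. (a, z) \<in> r \<and> (z, b) \<in> r}" for a b
  have "f (a, i) < f (b, i)" if "(a, b) \<in> r" "a \<noteq> b" "(a, i) \<in> D" "(b, i) \<in> D" for a b i
    using that
  proof (induction "card (I a b)" arbitrary: a b rule: less_induct)
    case less
    show ?case
    proof (cases "(a, b) \<in> covers P r")
      case True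
      then show ?thesis using cover less.prems by blast
    next
      case False
      then obtain z where z: "z \<in> P" "(a, z) \<in> r" "(z, b) \<in> r" "z \<noteq> a" "z \<noteq> b"
        using less.prems by (auto simp: covers_def D_iff)
      have P: "a \<in> P" "b \<in> P" using less.prems by (auto simp: D_iff)
      have rf: "(a, a) \<in> r" "(b, b) \<in> r"
        using P partial_order_onD(1)[OF po] by (auto simp: refl_on_def)
      have zD: "(z, i) \<in> D"
        using less.prems z u_antimono[of a z] v_mono[of z b] by (auto simp: D_iff)
      have finI: "finite (I a b)" using fin by (simp add: I_def)
      have "I a z \<subset> I a b"
      proof
        show "I a z \<subseteq> I a b" using z tr by (auto simp: I_def dest: transD)
        have "b \<in> I a b" "b \<notin> I a z"
          using P rf less.prems z anti by (auto simp: I_def dest: antisymD)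
        then show "I a z \<noteq> I a b" by blast
      qed
      moreover have "I z b \<subset> I a b"
      proof
        show "I z b \<subseteq> I a b" using z tr by (auto simp: I_def dest: transD)
        have "a \<in> I a b" "a \<notin> I z b"
          using P rf less.prems z anti by (auto simp: I_def dest: antisymD)
        then show "I z b \<noteq> I a b" by blast
      qed
      ultimately have "card (I a z) < card (I a b)" "card (I z b) < card (I a b)"
        using finI by (auto intro: psubset_card_mono)
      then have "f (a, i) < f (z, i)" "f (z, i) < f (b, i)"
        using less.hyps[of a z] less.hyps[of z b] less.prems z zD by auto
      then show ?thesis by simp
    qed
  qed
  then show ?thesis
    using ext mono range unfolding strict_labelings_def
    by (auto simp: PiE_def extensional_def)
qed

subsection \<open>Jumps and the bijection\<close>

lemma jump_bounds:
  assumes "p \<in> P"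
  shows "u p < J f p k" "J f p k \<le> l - v p + 1"
proof -
  let ?S = "{j. (p, j) \<in> fiber P l u v p \<and> k < f (p, j)}"
  have sub: "?S \<subseteq> {u p<..l - v p}" by (auto simp: fiber_def D_iff)
  then have "finite ?S" by (rule finite_subset) simp
  then have "Min ?S \<in> {u p<..l - v p}" if "?S \<noteq> {}"
    using Min_in[of ?S] that sub by blast
  then show "u p < J f p k" "J f p k \<le> l - v p + 1"
    using uv_le[OF assms] by (force simp: jump_def Let_def)+
qed

text \<open>Labels increase weakly along a fiber, so the positions with label above \<open>k\<close>
  form a final segment, which its minimum determines.\<close>

lemma less_label_iff:
  assumes f: "f \<in> L" and x: "(p, i) \<in> D"
  shows "k < f (p, i) \<longleftrightarrow> J f p k \<le> i"
proof -
  let ?S = "{j. (p, j) \<in> fiber P l u v p \<and> k < f (p, j)}"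
  have "?S \<subseteq> {u p<..l - v p}" by (auto simp: fiber_def D_iff)
  then have finS: "finite ?S" by (rule finite_subset) simp
  show ?thesis
  proof
    assume "k < f (p, i)"
    then have "i \<in> ?S" using x by (simp add: fiber_def)
    then show "J f p k \<le> i" using finS by (auto simp: jump_def Let_def)
  next
    assume le: "J f p k \<le> i"
    \<comment> \<open>The default jump lies one past the end of the fiber, so a jump at most
      \<open>i\<close> must come from a nonempty set.\<close>
    have "i \<le> l - v p" using x by (simp add: D_iff)
    then have ne: "?S \<noteq> {}" and m: "Min ?S \<le> i"
      using le by (auto simp: jump_def Let_def split: if_splits)
    have "Min ?S \<in> ?S" using finS ne by (rule Min_in)
    then have "(p, Min ?S) \<in> D" "k < f (p, Min ?S)" by (simp_all add: fiber_def)
    then show "k < f (p, i)" using L_mono[OF f m _ x] by simp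
  qed
qed

lemma Psi_apply: "p \<in> P \<Longrightarrow> 0 \<le> k \<Longrightarrow> k \<le> q \<Longrightarrow> Psi P l u v q f (p, k) = l + 1 - J f p k"
  by (simp add: Psi_def gamma_def)

lemma jump_step:
  assumes f: "f \<in> L" and p: "p \<in> P"
  shows "J f p (k - 1) \<le> J f p k"
proof (rule ccontr)
  assume "\<not> ?thesis"
  then have lt: "J f p k < J f p (k - 1)" by simp
  then have "(p, J f p k) \<in> D"
    using jump_bounds[OF p, of f k] jump_bounds[OF p, of f "k - 1"] p by (auto simp: D_iff)
  then show False
    using less_label_iff[OF f, of p "J f p k" k] less_label_iff[OF f, of p "J f p k" "k - 1"] lt
    by auto
qed

text \<open>At the position \<open>J f p (k - 1)\<close> the label over \<open>p\<close> is at least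
  \<open>k\<close>, so strictness pushes the label over \<open>p'\<close> above \<open>k\<close>. If
  the claim failed, monotonicity of \<open>u\<close> and \<open>v\<close> would put this position in
  both fibers.\<close>

lemma jump_cover:
  assumes f: "f \<in> L" and c: "(p, p') \<in> covers P r"
  shows "J f p' k \<le> J f p (k - 1)"
proof (rule ccontr)
  let ?i = "J f p (k - 1)"
  assume "\<not> ?thesis"
  then have lt: "?i < J f p' k" by simp
  note c' = coversD[OF c]
  have D: "(p, ?i) \<in> D" "(p', ?i) \<in> D"
    using lt c' jump_bounds[of p f "k - 1"] jump_bounds[of p' f k] u_antimono[of p p'] v_mono[of p p']
    by (auto simp: D_iff)
  then have "k - 1 < f (p, ?i)" "\<not> k < f (p', ?i)"
    using less_label_iff[OF f] lt by auto
  then show False using L_strict[OF f _ _ D] c' by auto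
qed

lemma Psi_cover_mono:
  assumes f: "f \<in> L" and "(x, y) \<in> gamma_cover P r q"
  shows "Psi P l u v q f x \<le> Psi P l u v q f y"
proof -
  from assms(2) consider
    p k where "x = (p, k)" "y = (p, k - 1)" "p \<in> P" "1 \<le> k" "k \<le> q" |
    p p' k where "x = (p, k - 1)" "y = (p', k)" "(p, p') \<in> covers P r" "1 \<le> k" "k \<le> q"
    by (auto simp: gamma_cover_def)
  then show ?thesis
  proof cases
    case 1
    then show ?thesis using jump_step[OF f, of p k] by (simp add: Psi_apply)
  next
    case 2
    then show ?thesis using jump_cover[OF f, of p p' k] coversD[of p p'] by (simp add: Psi_apply)
  qed
qed

lemma monotone_on_gamma_iff:
  "monotone_on (gamma P q) (\<lambda>x y. (x, y) \<in> gamma_le P r q) (\<le>) \<sigma> \<longleftrightarrow>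
    (\<forall>(x, y) \<in> gamma_cover P r q. \<sigma> x \<le> (\<sigma> y :: int))" (is "?M \<longleftrightarrow> ?C")
proof
  assume ?M
  then show ?C
    using gamma_cover_subset[of P r q] unfolding monotone_on_def gamma_le_def by blast
next
  assume C: ?C
  have "\<sigma> x \<le> \<sigma> y" if "(x, y) \<in> (gamma_cover P r q)\<^sup>*" for x y
    using that by (induction rule: rtrancl_induct) (use C in \<open>auto intro: order_trans\<close>)
  then show ?M by (auto simp: monotone_on_def gamma_le_def)
qed

lemma Psi_in_gamma_parts:
  assumes f: "f \<in> L"
  shows "Psi P l u v q f \<in> gamma_parts P r l u v q"
proof -
  have "Psi P l u v q f \<in> gamma P q \<rightarrow>\<^sub>E {0..l}"
  proof
    fix x assume "x \<in> gamma P q"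
    then obtain p k where x: "x = (p, k)" "p \<in> P" "0 \<le> k" "k \<le> q" by (auto simp: gamma_def)
    then show "Psi P l u v q f x \<in> {0..l}"
      using jump_bounds[of p f k] u_nonneg[of p] v_nonneg[of p] by (auto simp: Psi_apply)
  qed (simp add: Psi_def)
  \<comment> \<open>Every label exceeds 0 and none exceeds \<open>q\<close>, so the jumps at the two
    ends are the first position of the fiber and the one just past its last. These give the boundary
    values.\<close>
  moreover have "J f p 0 = u p + 1" if "p \<in> P" for p
    using that uv_le[of p] u_nonneg[of p] v_nonneg[of p] L_range[OF f, of p]
    by (intro jump_eqI) (force simp: D_iff)+
  moreover have "J f p q = l - v p + 1" if "p \<in> P" for p
    using that uv_le[of p] u_nonneg[of p] v_nonneg[of p] L_range[OF f, of p]
    by (intro jump_eqI) (force simp: D_iff)+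
  ultimately show ?thesis
    using Psi_cover_mono[OF f] q_pos
    by (auto simp: gamma_parts_def monotone_on_gamma_iff gamma_W_def gamma_B_def Psi_apply)
qed

text \<open>A label in \<open>{1..q}\<close> is the least \<open>k\<close> in \<open>{0..q}\<close>
  that it does not exceed, so the jumps at heights 0 to \<open>q\<close> recover it.\<close>

lemma inj_Psi: "inj_on (Psi P l u v q) L"
proof (rule inj_onI)
  fix f g assume f: "f \<in> L" and g: "g \<in> L" and eq: "Psi P l u v q f = Psi P l u v q g"
  have "f (p, i) = g (p, i)" for p i
  proof (cases "(p, i) \<in> D")
    case True
    then have p: "p \<in> P" by (simp add: D_iff)
    have J: "J f p k = J g p k" if "0 \<le> k" "k \<le> q" for k
      using fun_cong[OF eq, of "(p, k)"] p that by (simp add: Psi_apply)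
    have iff: "k < f (p, i) \<longleftrightarrow> k < g (p, i)" if "0 \<le> k" "k \<le> q" for k
      using J[OF that] less_label_iff[OF f True] less_label_iff[OF g True] by simp
    show ?thesis
      using iff[of "f (p, i)"] iff[of "g (p, i)"] L_range[OF f True] L_range[OF g True] by auto
  next
    case False
    then show ?thesis using L_extensional f g by metis
  qed
  then show "f = g" by auto
qed

text \<open>The preimage is read off from \<open>less_label_iff\<close>: with
  \<open>l + 1 - \<sigma> (p, k)\<close> as the intended jumps, the label at \<open>i\<close> is the
  least \<open>k\<close> whose jump lies beyond \<open>i\<close>.\<close>

lemma Psi_surj:
  assumes \<sigma>: "\<sigma> \<in> gamma_parts P r l u v q"
  shows "\<exists>f \<in> L. Psi P l u v q f = \<sigma>"
proof -
  have cov: "\<And>x y. (x, y) \<in> gamma_cover P r q \<Longrightarrow> \<sigma> x \<le> \<sigma> y"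
    using \<sigma> by (auto simp: gamma_parts_def monotone_on_gamma_iff)
  have down1: "\<sigma> (p, k) \<le> \<sigma> (p, k - 1)" if "p \<in> P" "1 \<le> k" "k \<le> q" for p k
    using that by (intro cov) (auto simp: gamma_cover_def)
  have up1: "\<sigma> (p, k - 1) \<le> \<sigma> (p', k)" if "(p, p') \<in> covers P r" "1 \<le> k" "k \<le> q" for p p' k
    using that by (intro cov) (auto simp: gamma_cover_def)
  have bd: "\<sigma> (p, 0) = l - u p" "\<sigma> (p, q) = v p" if "p \<in> P" for p
    using \<sigma> that q_pos by (auto simp: gamma_parts_def gamma_W_def gamma_B_def)
  \<comment> \<open>This makes the intended jumps increase with \<open>k\<close>, so the set in the
    definition of \<open>f\<close> below is closed upwards in \<open>{0..q}\<close>.\<close>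
  have anti: "\<sigma> (p, n) \<le> \<sigma> (p, m)" if p: "p \<in> P" and "0 \<le> m" "m \<le> n" "n \<le> q" for p m n
    using that(3,2,4)
  proof (induction n rule: int_ge_induct)
    case (step i)
    then show ?case using down1[OF p, of "i + 1"] by auto
  qed simp
  define f where "f = (\<lambda>(p, i). if (p, i) \<in> D then Min {k \<in> {0..q}. i < l + 1 - \<sigma> (p, k)}
    else undefined)"
  have less: "k < f (p, i) \<longleftrightarrow> l + 1 - \<sigma> (p, k) \<le> i" if D: "(p, i) \<in> D" and k: "0 \<le> k" "k \<le> q" for p i k
  proof -
    let ?S = "{k \<in> {0..q}. i < l + 1 - \<sigma> (p, k)}"
    have p: "p \<in> P" using D by (simp add: D_iff)
    \<comment> \<open>The boundary value \<open>\<sigma> (p, q) = v p\<close> makes the top jump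
      exceed every position of the fiber, so the minimum is taken over a nonempty set.\<close>
    have qS: "q \<in> ?S" using D q_pos bd[OF p] by (auto simp: D_iff)
    have fS: "f (p, i) = Min ?S" using D by (simp add: f_def)
    have finS: "finite ?S" by (rule finite_subset[of _ "{0..q}"]) auto
    have "Min ?S \<in> ?S" using qS finS by (intro Min_in) auto
    then have m: "0 \<le> f (p, i)" "f (p, i) \<le> q" "i < l + 1 - \<sigma> (p, f (p, i))" by (auto simp: fS)
    show ?thesis
    proof
      assume "k < f (p, i)"
      then have "k \<notin> ?S" using Min_le[OF finS, of k] by (auto simp: fS)
      then show "l + 1 - \<sigma> (p, k) \<le> i" using k by auto
    next
      assume "l + 1 - \<sigma> (p, k) \<le> i"
      then show "k < f (p, i)" using anti[OF p m(1), of k] m(3) k by (cases "f (p, i) \<le> k") auto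
    qed
  qed
  have range: "1 \<le> f (p, i) \<and> f (p, i) \<le> q" if D: "(p, i) \<in> D" for p i
    using less[OF D, of 0] less[OF D, of q] bd[of p] D q_pos by (auto simp: D_iff)
  have f: "f \<in> L"
  proof (rule L_coverI)
    fix p p' i assume c: "(p, p') \<in> covers P r" and D: "(p, i) \<in> D" "(p', i) \<in> D"
    \<comment> \<open>With \<open>k = f (p, i)\<close>, the intended jump of \<open>p\<close> at
      \<open>k - 1\<close> is at most \<open>i\<close>. The cover from \<open>(p, k - 1)\<close> to
      \<open>(p', k)\<close> carries this bound to the jump of \<open>p'\<close> at
      \<open>k\<close>.\<close>
    show "f (p, i) < f (p', i)"
      using less[OF D(1), of "f (p, i) - 1"] range[OF D(1)] up1[OF c, of "f (p, i)"]
        less[OF D(2), of "f (p, i)"] by auto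
  next
    fix p i j assume ij: "i \<le> j" and D: "(p, i) \<in> D" "(p, j) \<in> D"
    show "f (p, i) \<le> f (p, j)"
      using less[OF D(1), of "f (p, j)"] less[OF D(2), of "f (p, j)"] range[OF D(2)] ij by auto
  next
    fix x assume "x \<notin> D"
    then show "f x = undefined" by (cases x) (simp add: f_def)
  qed (use range in auto)
  have J: "J f p k = l + 1 - \<sigma> (p, k)" if p: "p \<in> P" and k: "0 \<le> k" "k \<le> q" for p k
  proof (rule jump_eqI)
    show "u p < l + 1 - \<sigma> (p, k)" "l + 1 - \<sigma> (p, k) \<le> l - v p + 1"
      using anti[OF p, of 0 k] anti[OF p, of k q] bd[OF p] k by auto
  qed (use p k less u_nonneg v_nonneg in auto)
  have "Psi P l u v q f x = \<sigma> x" for x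
  proof (cases "x \<in> gamma P q")
    case True
    then show ?thesis by (auto simp: gamma_def Psi_apply J)
  next
    case False
    moreover have "\<sigma> \<in> extensional (gamma P q)"
      using \<sigma> by (auto simp: gamma_parts_def PiE_def)
    ultimately show ?thesis by (cases x) (simp add: Psi_def extensional_def)
  qed
  then show ?thesis using f by blast
qed

lemma bij_betw_Psi: "bij_betw (Psi P l u v q) L (gamma_parts P r l u v q)"
  unfolding bij_betw_def using inj_Psi Psi_in_gamma_parts Psi_surj by blast

subsection \<open>Free labels\<close>

text \<open>To keep the fiber monotone, the equal labels to the right of \<open>i\<close> are raised
  along with it. An upper cover that leaves room at \<open>i\<close> leaves room further right too,
  because its labels increase weakly.\<close>

lemma ex_raise:
  assumes f: "f \<in> L" and x: "(p, i) \<in> D" and top: "f (p, i) < q"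
    and above: "\<And>p'. (p, p') \<in> covers P r \<Longrightarrow> (p', i) \<in> D \<Longrightarrow> f (p, i) + 1 < f (p', i)"
  shows "\<exists>g \<in> L. g (p, i) = f (p, i) + 1 \<and> (\<forall>p' i'. p' \<noteq> p \<longrightarrow> g (p', i') = f (p', i'))"
proof -
  define g where "g = (\<lambda>(a, j). if a = p \<and> i \<le> j \<and> (a, j) \<in> D \<and> f (a, j) = f (p, i)
    then f (a, j) + 1 else f (a, j))"
  have "g \<in> L"
  proof (rule L_coverI)
    fix y assume "y \<notin> D"
    then show "g y = undefined" using L_extensional[OF f] by (cases y) (auto simp: g_def)
  next
    fix a b j assume c: "(a, b) \<in> covers P r" and D: "(a, j) \<in> D" "(b, j) \<in> D"
    note c' = coversD[OF c]
    have lt: "f (a, j) < f (b, j)" using L_strict[OF f _ _ D] c' by auto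
    show "g (a, j) < g (b, j)"
    proof (cases "a = p \<and> i \<le> j \<and> f (a, j) = f (p, i)")
      case True
      \<comment> \<open>The position \<open>i\<close> is not too small for \<open>b\<close> since
        \<open>u b \<le> u a\<close>, and not too large since \<open>i \<le> j\<close>.\<close>
      have bi: "(b, i) \<in> D"
        using True D x u_antimono[of a b] c' by (auto simp: D_iff)
      then have "f (p, i) + 1 < f (b, i)" using above c True by auto
      moreover have "f (b, i) \<le> f (b, j)" using L_mono[OF f _ bi D(2)] True by auto
      ultimately show ?thesis using True c' by (auto simp: g_def)
    next
      case False
      then show ?thesis using lt by (auto simp: g_def)
    qed
  next
    fix a j m assume "j \<le> m" and D: "(a, j) \<in> D" "(a, m) \<in> D"
    then show "g (a, j) \<le> g (a, m)" using L_mono[OF f, of j m a] by (auto simp: g_def)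
  next
    fix a j assume "(a, j) \<in> D"
    then show "1 \<le> g (a, j) \<and> g (a, j) \<le> q"
      using L_range[OF f, of a j] top by (auto simp: g_def)
  qed
  moreover have "g (p, i) = f (p, i) + 1" using x by (simp add: g_def)
  ultimately show ?thesis by (intro bexI[of _ g]) (auto simp: g_def)
qed

text \<open>Dual to \<open>ex_raise\<close>: the equal labels to the left of \<open>i\<close> are
  lowered as well, and \<open>v_mono\<close> takes over the role of
  \<open>u_antimono\<close>.\<close>

lemma ex_lower:
  assumes f: "f \<in> L" and x: "(p, i) \<in> D" and bot: "1 < f (p, i)"
    and below: "\<And>p'. (p', p) \<in> covers P r \<Longrightarrow> (p', i) \<in> D \<Longrightarrow> f (p', i) < f (p, i) - 1"
  shows "\<exists>g \<in> L. g (p, i) = f (p, i) - 1 \<and> (\<forall>p' i'. p' \<noteq> p \<longrightarrow> g (p', i') = f (p', i'))"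
proof -
  define g where "g = (\<lambda>(a, j). if a = p \<and> j \<le> i \<and> (a, j) \<in> D \<and> f (a, j) = f (p, i)
    then f (a, j) - 1 else f (a, j))"
  have "g \<in> L"
  proof (rule L_coverI)
    fix y assume "y \<notin> D"
    then show "g y = undefined" using L_extensional[OF f] by (cases y) (auto simp: g_def)
  next
    fix a b j assume c: "(a, b) \<in> covers P r" and D: "(a, j) \<in> D" "(b, j) \<in> D"
    note c' = coversD[OF c]
    have lt: "f (a, j) < f (b, j)" using L_strict[OF f _ _ D] c' by auto
    show "g (a, j) < g (b, j)"
    proof (cases "b = p \<and> j \<le> i \<and> f (b, j) = f (p, i)")
      case True
      have ai: "(a, i) \<in> D"
        using True D x v_mono[of a b] c' by (auto simp: D_iff)
      then have "f (a, i) < f (p, i) - 1" using below c True by auto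
      moreover have "f (a, j) \<le> f (a, i)" using L_mono[OF f _ D(1) ai] True by auto
      ultimately show ?thesis using True c' by (auto simp: g_def)
    next
      case False
      then show ?thesis using lt by (auto simp: g_def)
    qed
  next
    fix a j m assume "j \<le> m" and D: "(a, j) \<in> D" "(a, m) \<in> D"
    then show "g (a, j) \<le> g (a, m)" using L_mono[OF f, of j m a] by (auto simp: g_def)
  next
    fix a j assume "(a, j) \<in> D"
    then show "1 \<le> g (a, j) \<and> g (a, j) \<le> q"
      using L_range[OF f, of a j] bot by (auto simp: g_def)
  qed
  moreover have "g (p, i) = f (p, i) - 1" using x by (simp add: g_def)
  ultimately show ?thesis by (intro bexI[of _ g]) (auto simp: g_def)
qed

text \<open>Labels over other elements stay fixed, so any raise forces a gap of at least two below
  each upper cover. Such gaps already permit a raise by one.\<close>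

lemma raisable_iff:
  assumes f: "f \<in> L" and x: "(p, i) \<in> D"
  shows "raisable P r l u v R f p i \<longleftrightarrow> f (p, i) < q \<and>
    (\<forall>p'. (p, p') \<in> covers P r \<and> (p', i) \<in> D \<longrightarrow> f (p, i) + 1 < f (p', i))" (is "_ \<longleftrightarrow> ?C")
proof
  assume "raisable P r l u v R f p i"
  then obtain g where g: "g \<in> L" "f (p, i) < g (p, i)"
    and same: "\<And>p' i'. (p', i') \<in> D \<Longrightarrow> p' \<noteq> p \<Longrightarrow> g (p', i') = f (p', i')"
    unfolding raisable_def strict_labelings_global_restr by blast
  have "f (p, i) + 1 < f (p', i)" if c: "(p, p') \<in> covers P r" and D: "(p', i) \<in> D" for p'
    using L_strict[OF g(1) _ _ x D] coversD[OF c] same[OF D] g(2) by auto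
  then show ?C using L_range[OF g(1) x] g(2) by auto
next
  assume ?C
  then obtain g where "g \<in> L" "g (p, i) = f (p, i) + 1"
    "\<forall>p' i'. p' \<noteq> p \<longrightarrow> g (p', i') = f (p', i')"
    using ex_raise[OF f x] by blast
  then show "raisable P r l u v R f p i"
    unfolding raisable_def strict_labelings_global_restr by (intro bexI[of _ g]) auto
qed

lemma lowerable_iff:
  assumes f: "f \<in> L" and x: "(p, i) \<in> D"
  shows "lowerable P r l u v R f p i \<longleftrightarrow> 1 < f (p, i) \<and>
    (\<forall>p'. (p', p) \<in> covers P r \<and> (p', i) \<in> D \<longrightarrow> f (p', i) < f (p, i) - 1)" (is "_ \<longleftrightarrow> ?C")
proof
  assume "lowerable P r l u v R f p i"
  then obtain g where g: "g \<in> L" "g (p, i) < f (p, i)"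
    and same: "\<And>p' i'. (p', i') \<in> D \<Longrightarrow> p' \<noteq> p \<Longrightarrow> g (p', i') = f (p', i')"
    unfolding lowerable_def strict_labelings_global_restr by blast
  have "f (p', i) < f (p, i) - 1" if c: "(p', p) \<in> covers P r" and D: "(p', i) \<in> D" for p'
    using L_strict[OF g(1) _ _ D x] coversD[OF c] same[OF D] g(2) by auto
  then show ?C using L_range[OF g(1) x] g(2) by auto
next
  assume ?C
  then obtain g where "g \<in> L" "g (p, i) = f (p, i) - 1"
    "\<forall>p' i'. p' \<noteq> p \<longrightarrow> g (p', i') = f (p', i')"
    using ex_lower[OF f x] by blast
  then show "lowerable P r l u v R f p i"
    unfolding lowerable_def strict_labelings_global_restr by (intro bexI[of _ g]) auto
qed

text \<open>The labeling raised by one attains the new value. Hence a label can be free only if its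
  neighbouring integer also lies in the restriction set.\<close>

lemma raisable_Suc_in_R:
  assumes "f \<in> L" "(p, i) \<in> D" "raisable P r l u v R f p i"
  shows "f (p, i) + 1 \<in> R p"
  using assms ex_raise[OF assms(1,2)] L_in_R[OF _ assms(2)] raisable_iff[OF assms(1,2)] by metis

lemma lowerable_pred_in_R:
  assumes "f \<in> L" "(p, i) \<in> D" "lowerable P r l u v R f p i"
  shows "f (p, i) - 1 \<in> R p"
  using assms ex_lower[OF assms(1,2)] L_in_R[OF _ assms(2)] lowerable_iff[OF assms(1,2)] by metis

section \<open>Toggle bounds and the positions of free labels\<close>

text \<open>Subtraction from \<open>l + 1\<close> turns values of \<open>Psi\<close> back into
  positions: the minimum over upper covers becomes the largest of their jumps. In these terms a
  toggle reflects the jump between \<open>up_bound\<close> and \<open>down_bound\<close>.\<close>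

definition up_bound :: "('a \<times> int \<Rightarrow> int) \<Rightarrow> 'a \<Rightarrow> int \<Rightarrow> int" where
  "up_bound f p k = l + 1 - Min (Psi P l u v q f ` {y. ((p, k), y) \<in> gamma_cover P r q})"

definition down_bound :: "('a \<times> int \<Rightarrow> int) \<Rightarrow> 'a \<Rightarrow> int \<Rightarrow> int" where
  "down_bound f p k = l + 1 - Max (Psi P l u v q f ` {z. (z, (p, k)) \<in> gamma_cover P r q})"

lemma up_bound_le_iff:
  assumes p: "p \<in> P" and k: "0 < k" "k < q"
  shows "up_bound f p k \<le> i \<longleftrightarrow>
    J f p (k - 1) \<le> i \<and> (\<forall>p'. (p, p') \<in> covers P r \<longrightarrow> J f p' (k + 1) \<le> i)"
proof -
  let ?C = "{p'. (p, p') \<in> covers P r}"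
  have "{y. ((p, k), y) \<in> gamma_cover P r q} = insert (p, k - 1) ((\<lambda>p'. (p', k + 1)) ` ?C)"
    using p k by (auto simp: gamma_cover_def)
  moreover have "Psi P l u v q f (p', k + 1) = l + 1 - J f p' (k + 1)" if "p' \<in> ?C" for p'
    using that coversD[of p p'] k by (simp add: Psi_apply)
  ultimately have im: "Psi P l u v q f ` {y. ((p, k), y) \<in> gamma_cover P r q} =
      insert (l + 1 - J f p (k - 1)) ((\<lambda>p'. l + 1 - J f p' (k + 1)) ` ?C)"
    using p k by (auto simp: image_image Psi_apply)
  have "finite ?C" using coversD by (intro finite_subset[OF _ fin]) blast
  then have "l + 1 - i \<le> Min (Psi P l u v q f ` {y. ((p, k), y) \<in> gamma_cover P r q}) \<longleftrightarrow>
      J f p (k - 1) \<le> i \<and> (\<forall>p'. (p, p') \<in> covers P r \<longrightarrow> J f p' (k + 1) \<le> i)"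
    unfolding im by (subst Min_ge_iff) auto
  then show ?thesis by (simp add: up_bound_def algebra_simps)
qed

lemma less_down_bound_iff:
  assumes p: "p \<in> P" and k: "0 < k" "k < q"
  shows "i < down_bound f p k \<longleftrightarrow>
    i < J f p (k + 1) \<and> (\<forall>p'. (p', p) \<in> covers P r \<longrightarrow> i < J f p' (k - 1))"
proof -
  let ?C = "{p'. (p', p) \<in> covers P r}"
  have "{z. (z, (p, k)) \<in> gamma_cover P r q} = insert (p, k + 1) ((\<lambda>p'. (p', k - 1)) ` ?C)"
    using p k by (auto simp: gamma_cover_def)
  moreover have "Psi P l u v q f (p', k - 1) = l + 1 - J f p' (k - 1)" if "p' \<in> ?C" for p'
    using that coversD[of p' p] k by (simp add: Psi_apply)
  ultimately have im: "Psi P l u v q f ` {z. (z, (p, k)) \<in> gamma_cover P r q} =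
      insert (l + 1 - J f p (k + 1)) ((\<lambda>p'. l + 1 - J f p' (k - 1)) ` ?C)"
    using p k by (auto simp: image_image Psi_apply)
  have "finite ?C" using coversD by (intro finite_subset[OF _ fin]) blast
  then have "Max (Psi P l u v q f ` {z. (z, (p, k)) \<in> gamma_cover P r q}) < l + 1 - i \<longleftrightarrow>
      i < J f p (k + 1) \<and> (\<forall>p'. (p', p) \<in> covers P r \<longrightarrow> i < J f p' (k - 1))"
    unfolding im by (subst Max_less_iff) auto
  then show ?thesis by (simp add: down_bound_def algebra_simps)
qed

lemma up_bound_le_jump:
  assumes "f \<in> L" "p \<in> P" "0 < k" "k < q"
  shows "up_bound f p k \<le> J f p k"
  using assms jump_step[of f p k] jump_cover[of f p _ "k + 1"] by (auto simp: up_bound_le_iff)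

lemma jump_le_down_bound:
  assumes "f \<in> L" "p \<in> P" "0 < k" "k < q"
  shows "J f p k \<le> down_bound f p k"
proof -
  \<comment> \<open>The criterion for \<open>down_bound\<close> is strict, so it is applied to the
    position just before the jump.\<close>
  have "J f p k - 1 < J f p (k + 1)" using jump_step[of f p "k + 1"] assms by auto
  moreover have "J f p k - 1 < J f p' (k - 1)" if "(p', p) \<in> covers P r" for p'
    using jump_cover[OF assms(1) that, of k] by auto
  ultimately show ?thesis
    using less_down_bound_iff[OF assms(2-4), of "J f p k - 1" f] by auto
qed

text \<open>In terms of jumps, a label equals \<open>k\<close> between the jumps at
  \<open>k - 1\<close> and \<open>k\<close>, and the gap below \<open>p'\<close> says that the jump
  of \<open>p'\<close> at \<open>k + 1\<close> has been reached. Together these are the inequalities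
  defining the interval.\<close>

lemma raisable_positions:
  assumes f: "f \<in> L" and p: "p \<in> P" and k: "0 < k" "k < q"
  shows "{i. (p, i) \<in> D \<and> f (p, i) = k \<and> raisable P r l u v R f p i} = {up_bound f p k..<J f p k}"
proof (rule set_eqI)
  fix i
  show "i \<in> {i. (p, i) \<in> D \<and> f (p, i) = k \<and> raisable P r l u v R f p i} \<longleftrightarrow>
      i \<in> {up_bound f p k..<J f p k}"
  proof (cases "(p, i) \<in> D")
    case D: True
    have label: "f (p, i) = k \<longleftrightarrow> J f p (k - 1) \<le> i \<and> i < J f p k"
      using less_label_iff[OF f D, of k] less_label_iff[OF f D, of "k - 1"] by auto
    have cov: "((p', i) \<in> D \<longrightarrow> k + 1 < f (p', i)) \<longleftrightarrow> J f p' (k + 1) \<le> i"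
      if c: "(p, p') \<in> covers P r" for p'
    proof (cases "(p', i) \<in> D")
      case True
      then show ?thesis using less_label_iff[OF f] by auto
    next
      case False
      \<comment> \<open>The fiber over \<open>p'\<close> starts no later than that over
        \<open>p\<close>, so \<open>i\<close> can only lie past its end. There every jump of
        \<open>p'\<close> has been reached, and an absent neighbour imposes no condition.\<close>
      then have "l - v p' < i" using D coversD[OF c] u_antimono[of p p'] by (auto simp: D_iff)
      then show ?thesis using False jump_bounds[of p' f "k + 1"] coversD[OF c] by auto
    qed
    show ?thesis
      using D k label cov by (auto simp: raisable_iff[OF f D] up_bound_le_iff[OF p k])
  next
    case False
    then show ?thesis
      using p jump_bounds[OF p, of f "k - 1"] jump_bounds[OF p, of f k]
      by (auto simp: up_bound_le_iff[OF p k] D_iff)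
  qed
qed

lemma lowerable_positions:
  assumes f: "f \<in> L" and p: "p \<in> P" and k: "0 < k" "k < q"
  shows "{i. (p, i) \<in> D \<and> f (p, i) = k + 1 \<and> lowerable P r l u v R f p i}
    = {J f p k..<down_bound f p k}"
proof (rule set_eqI)
  fix i
  show "i \<in> {i. (p, i) \<in> D \<and> f (p, i) = k + 1 \<and> lowerable P r l u v R f p i} \<longleftrightarrow>
      i \<in> {J f p k..<down_bound f p k}"
  proof (cases "(p, i) \<in> D")
    case D: True
    have label: "f (p, i) = k + 1 \<longleftrightarrow> J f p k \<le> i \<and> i < J f p (k + 1)"
      using less_label_iff[OF f D, of k] less_label_iff[OF f D, of "k + 1"] by auto
    have cov: "((p', i) \<in> D \<longrightarrow> f (p', i) < k) \<longleftrightarrow> i < J f p' (k - 1)"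
      if c: "(p', p) \<in> covers P r" for p'
    proof (cases "(p', i) \<in> D")
      case True
      then show ?thesis using less_label_iff[OF f True, of "k - 1"] by auto
    next
      case False
      \<comment> \<open>Here \<open>i\<close> can only lie before the start of the fiber over
        \<open>p'\<close>, hence before all of its jumps.\<close>
      then have "i \<le> u p'" using D coversD[OF c] v_mono[of p' p] by (auto simp: D_iff)
      then show ?thesis using False jump_bounds[of p' f "k - 1"] coversD[OF c] by auto
    qed
    show ?thesis
      using D k label cov by (auto simp: lowerable_iff[OF f D] less_down_bound_iff[OF p k])
  next
    case False
    then show ?thesis
      using p jump_bounds[OF p, of f "k + 1"] jump_bounds[OF p, of f k]
      by (auto simp: less_down_bound_iff[OF p k] D_iff)
  qed
qed

lemma next_label_props:
  assumes "k \<in> R p" "k \<noteq> Max (R p)"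
  shows "next_label R p k \<in> R p" "k < next_label R p k"
    and "\<And>m. m \<in> R p \<Longrightarrow> k < m \<Longrightarrow> next_label R p k \<le> m"
proof -
  have fR: "finite (R p)"
    by (rule finite_subset[of _ "{1..q}"]) (auto simp: global_restr_def)
  have "Max (R p) \<in> R p" "k \<le> Max (R p)" using fR assms by (auto intro: Max_in)
  then have "Max (R p) \<in> {m \<in> R p. k < m}" using assms(2) by auto
  then have "Min {m \<in> R p. k < m} \<in> {m \<in> R p. k < m}" using fR by (intro Min_in) auto
  then show "next_label R p k \<in> R p" "k < next_label R p k" by (auto simp: next_label_def)
  show "next_label R p k \<le> m" if "m \<in> R p" "k < m" for m
    using that fR by (auto simp: next_label_def)
qed

subsection \<open>Bender--Knuth moves are toggles\<close>

text \<open>One formula serves both cases. If the move does not exchange \<open>k\<close> with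
  \<open>k + 1\<close>, then \<open>A\<close>, \<open>j\<close> and \<open>B\<close> coincide and
  the formula returns \<open>f (p, i)\<close>.\<close>

lemma bender_knuth_apply:
  assumes f: "f \<in> L" and x: "(p, i) \<in> D" and k: "0 < k" "k < q"
  defines "A \<equiv> up_bound f p k" and "B \<equiv> down_bound f p k" and "j \<equiv> J f p k"
  shows "bender_knuth P r l u v R k f (p, i) =
    (if A \<le> i \<and> i < A + B - j then k else if A + B - j \<le> i \<and> i < B then k + 1 else f (p, i))"
proof -
  have p: "p \<in> P" using x by (simp add: D_iff)
  let ?lo = "free_low P r l u v R k f p" and ?hi = "free_high P r l u v R k f p"
  have lo: "?lo = {A..<j}"
    using raisable_positions[OF f p k] by (simp add: free_low_def fiber_def A_def j_def)
  note hi = lowerable_positions[OF f p k, folded B_def j_def]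
  have AB: "A \<le> j" "j \<le> B"
    using up_bound_le_jump[OF f p k] jump_le_down_bound[OF f p k] by (auto simp: A_def B_def j_def)
  show ?thesis
  proof (cases "k \<in> R p \<and> k \<noteq> Max (R p) \<and> next_label R p k = k + 1")
    case True
    have hi': "?hi = {j..<B}"
      using hi True by (simp add: free_high_def fiber_def)
    have S: "?lo \<union> ?hi = {A..<B}" using AB by (auto simp: lo hi')
    \<comment> \<open>There are \<open>i - A\<close> free positions before \<open>i\<close>, and
      \<open>B - j\<close> of the free positions receive \<open>k\<close>.\<close>
    have pos: "card {m \<in> {A..<B}. m < i} < card ?hi \<longleftrightarrow> i < A + B - j" if i: "i \<in> {A..<B}"
    proof -
      have eq: "{m \<in> {A..<B}. m < i} = {A..<i}" using i by auto
      show ?thesis unfolding eq hi' using i AB by auto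
    qed
    have "bender_knuth P r l u v R k f (p, i) =
        (if i \<in> {A..<B} then if card {m \<in> {A..<B}. m < i} < card ?hi then k else k + 1
         else f (p, i))"
      unfolding bender_knuth_def Let_def prod.case S using p True by simp
    then show ?thesis
      using pos AB by (cases "i \<in> {A..<B}") auto
  next
    case False
    have "\<not> (k \<in> R p \<and> k + 1 \<in> R p)"
    proof
      assume R: "k \<in> R p \<and> k + 1 \<in> R p"
      have "finite (R p)"
        by (rule finite_subset[of _ "{1..q}"]) (auto simp: global_restr_def)
      then have "k + 1 \<le> Max (R p)" using R by auto
      then have "k \<noteq> Max (R p)" by auto
      then show False
        using False R next_label_props[of k p] by force
    qed
    \<comment> \<open>A raisable \<open>k\<close> or a lowerable \<open>k + 1\<close> would put both
      integers into \<open>R p\<close>. Both intervals are therefore empty.\<close>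
    then have "?lo = {}" "{i. (p, i) \<in> D \<and> f (p, i) = k + 1 \<and> lowerable P r l u v R f p i} = {}"
      using L_in_R[OF f, of p] raisable_Suc_in_R[OF f, of p] lowerable_pred_in_R[OF f, of p]
      by (fastforce simp: free_low_def fiber_def)+
    then have eq: "A = j" "B = j" using AB lo hi by auto
    \<comment> \<open>The actual next label is now larger than \<open>k + 1\<close>. Were it
      lowerable, its predecessor would be an element of \<open>R p\<close> strictly between it and
      \<open>k\<close>.\<close>
    have "?hi = {}" if act: "k \<in> R p" "k \<noteq> Max (R p)"
    proof (rule ccontr)
      assume "?hi \<noteq> {}"
      then obtain m where "(p, m) \<in> D" "f (p, m) = next_label R p k" "lowerable P r l u v R f p m"
        by (auto simp: free_high_def fiber_def)
      then have "next_label R p k - 1 \<in> R p" using lowerable_pred_in_R[OF f, of p m] by simp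
      then show False
        using next_label_props[OF act] act False by force
    qed
    then show ?thesis
      using \<open>?lo = {}\<close> eq by (auto simp: bender_knuth_def Let_def)
  qed
qed

text \<open>Only labels equal to \<open>k\<close> or \<open>k + 1\<close> are changed, and only to
  these values. Comparisons with any \<open>m \<noteq> k\<close> are unaffected, so just the jump at
  \<open>k\<close> moves.\<close>

lemma jump_bender_knuth:
  assumes f: "f \<in> L" and p: "p \<in> P" and k: "0 < k" "k < q"
  shows "J (bender_knuth P r l u v R k f) p m =
    (if m = k then up_bound f p k + down_bound f p k - J f p k else J f p m)"
proof -
  let ?A = "up_bound f p k" and ?B = "down_bound f p k" and ?j = "J f p k"
  have AB: "?A \<le> ?j" "?j \<le> ?B"
    using up_bound_le_jump[OF f p k] jump_le_down_bound[OF f p k] by auto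
  have A: "J f p (k - 1) \<le> ?A" using up_bound_le_iff[OF p k, of f ?A] by auto
  have B: "?B \<le> J f p (k + 1)" using less_down_bound_iff[OF p k, of "?B - 1" f] by auto
  note bounds = jump_bounds[OF p, of f]
  show ?thesis
  proof (rule jump_eqI)
    show "u p < (if m = k then ?A + ?B - ?j else J f p m)"
      "(if m = k then ?A + ?B - ?j else J f p m) \<le> l - v p + 1"
      using AB A B bounds(1)[of "k - 1"] bounds(2)[of "k + 1"] bounds[of m] by auto
  next
    fix i assume D: "(p, i) \<in> D"
    note less = less_label_iff[OF f D]
    \<comment> \<open>The interval from \<open>?A\<close> to \<open>?B\<close> lies between the
      jumps at \<open>k - 1\<close> and \<open>k + 1\<close>.\<close>
    have mid: "f (p, i) = k \<or> f (p, i) = k + 1" if "?A \<le> i" "i < ?B"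
      using less[of "k - 1"] less[of "k + 1"] A B that by auto
    show "m < bender_knuth P r l u v R k f (p, i) \<longleftrightarrow>
        (if m = k then ?A + ?B - ?j else J f p m) \<le> i"
    proof (cases "?A \<le> i \<and> i < ?B")
      case True
      then show ?thesis
        using mid less[of m] AB by (auto simp: bender_knuth_apply[OF f D k])
    next
      case False
      then show ?thesis
        using less[of m] AB by (auto simp: bender_knuth_apply[OF f D k])
    qed
  qed (use p u_nonneg v_nonneg in auto)
qed

text \<open>In an active fiber both \<open>k\<close> and a larger label belong to
  \<open>{1..q}\<close>, which forces \<open>0 < k < q\<close>.\<close>

lemma bender_knuth_outside:
  assumes "\<not> (0 < k \<and> k < q)"
  shows "bender_knuth P r l u v R k f = f"
proof -
  have "\<not> (k \<in> R p \<and> k \<noteq> Max (R p))" for p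
  proof
    assume act: "k \<in> R p \<and> k \<noteq> Max (R p)"
    then have "next_label R p k \<le> q" "k < next_label R p k" "1 \<le> k"
      using next_label_props[of k p] by (auto simp: global_restr_def)
    then show False using assms by auto
  qed
  then show ?thesis by (auto simp: bender_knuth_def fun_eq_iff Let_def)
qed

lemma toggle_row_apply:
  "toggle_row P r q k \<sigma> =
    (\<lambda>(p, m). if m = k \<and> p \<in> P \<and> 0 < k \<and> k < q then toggle P r q (p, k) \<sigma> (p, k) else \<sigma> (p, m))"
proof -
  have "{p. (p, k) \<in> gamma P q - gamma_W P q} = (if 0 < k \<and> k < q then P else {})"
    by (auto simp: gamma_def gamma_W_def)
  then show ?thesis using fin by (auto simp: toggle_row_def fold_toggle fun_eq_iff)
qed

text \<open>For \<open>0 < k < q\<close> the reflected jump, subtracted from \<open>l + 1\<close>,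
  is the minimum plus the maximum minus the old value of \<open>Psi\<close>. For other
  \<open>k\<close> both sides are the identity move.\<close>

lemma Psi_bender_knuth:
  assumes f: "f \<in> L"
  shows "Psi P l u v q (bender_knuth P r l u v R k f) = toggle_row P r q k (Psi P l u v q f)"
proof (cases "0 < k \<and> k < q")
  case False
  then show ?thesis by (auto simp: bender_knuth_outside toggle_row_apply)
next
  case True
  then have k: "0 < k" "k < q" by auto
  show ?thesis
  proof (rule ext)
    fix x :: "'a \<times> int"
    obtain p m where x: "x = (p, m)" by (cases x)
    show "Psi P l u v q (bender_knuth P r l u v R k f) x = toggle_row P r q k (Psi P l u v q f) x"
    proof (cases "p \<in> P \<and> 0 \<le> m \<and> m \<le> q")
      case True
      then show ?thesis
        using k by (auto simp: x toggle_row_apply Psi_apply jump_bender_knuth[OF f] toggle_def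
            up_bound_def down_bound_def)
    next
      case False
      then show ?thesis using k by (auto simp: x toggle_row_apply Psi_def gamma_def)
    qed
  qed
qed

end

theorem theorem4p8:
  fixes P :: "'a set" and r :: "('a \<times> 'a) set"
    and l q :: int and u v :: "'a \<Rightarrow> int"
  assumes "finite P" and "partial_order_on P r"
    and "0 < l" and "0 < q"
    and "u \<in> P \<rightarrow> {0..l}" and "v \<in> P \<rightarrow> {0..l}"
    and "\<And>p. p \<in> P \<Longrightarrow> u p + v p \<le> l"
    and "\<And>p1 p2. (p1, p2) \<in> r \<Longrightarrow> v p1 \<le> v p2"
    and "\<And>p1 p2. (p1, p2) \<in> r \<Longrightarrow> u p1 \<ge> u p2"
    and "strict_labelings P r l u v (\<lambda>_. {1..q}) \<noteq> {}"
  shows "bij_betw (Psi P l u v q)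
           (strict_labelings P r l u v (global_restr P r l u v q))
           (gamma_parts P r l u v q)
       \<and> (\<forall>k. \<forall>f \<in> strict_labelings P r l u v (global_restr P r l u v q).
             Psi P l u v q (bender_knuth P r l u v (global_restr P r l u v q) k f)
               = toggle_row P r q k (Psi P l u v q f))"
proof -
  interpret strict_labeling_setup P r l q u v
    using assms by unfold_locales (auto simp: Pi_iff)
  show ?thesis
    using bij_betw_Psi Psi_bender_knuth by (simp add: strict_labelings_global_restr)
qed

end
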